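(* Let $p$ be a prime, let $m$ be a positive integer, and put $\alpha=\mathrm{ord}_p(m)$. Let $l,n\in\mathbb N$ and $r\in\mathbb Z$. Then $$\mathrm{ord}_p\left(\sum_{k\equiv r\ (\mathrm{mod}\ p^{\alpha})}\binom nk(-1)^kB_l\left(\frac{k-r}m\right)\right)\geq\left\lfloor\frac{n-p^{\alpha-1}-l(\delta_{\alpha,0}+\delta_{\alpha,1})}{\varphi(p^{\alpha})}\right\rfloor-l\alpha,$$ where $B_l(x)$ is the Bernoulli polynomial of degree $l$.
   Context: $\mathbb N=\{0,1,2,\ldots\}$. $\mathrm{ord}_p$ denotes the $p$-adic order, with $\mathrm{ord}_p(0)=+\infty$. The Bernoulli polynomials are defined by $\frac{te^{xt}}{e^t-1}=\sum_{l\ge0}B_l(x)\frac{t^l}{l!}$. $\varphi$ is Euler's totient function, with $\varphi(p^0)=1$. When $\alpha=0$, $p^{\alpha-1}$ denotes the rational number $1/p$. $\lfloor\cdot\rfloor$ is the floor function. $\delta_{m,n}$ is $1$ if $m=n$ and $0$ otherwise. The sum runs over all integers $k$ in the given residue class; since $\binom nk=0$ for $k<0$ or $k>n$, only terms with $0\leq k\leq n$ contribute. *)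

theory Defs
  imports
    "HOL-Computational_Algebra.Formal_Power_Series"
    "HOL-Number_Theory.Number_Theory"
    "HOL-Library.Extended"
begin

text \<open>
  The value at \<open>x\<close> of the Bernoulli polynomial \<open>B\<^sub>l\<close>, read off from the
  generating function \<open>t e\<^sup>x\<^sup>t / (e\<^sup>t - 1)\<close>. The denominator has subdegree 1 and the numerator
  is divisible by \<open>t\<close>, so the division of formal power series is exact; see
  \<open>bernoulli_poly_generating_function\<close> below.
\<close>

definition bernoulli_poly :: "nat \<Rightarrow> rat \<Rightarrow> rat" where
  "bernoulli_poly l x = fact l * fps_nth (fps_X * fps_exp x / (fps_exp 1 - 1)) l"

lemma bernoulli_poly_generating_function:
  "Abs_fps (\<lambda>l. bernoulli_poly l x / fact l) * (fps_exp 1 - 1) = fps_X * fps_exp x"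
proof -
  let ?D = "fps_exp 1 - 1 :: rat fps" and ?N = "fps_X * fps_exp x"
  have D1: "fps_nth ?D 1 \<noteq> 0" by simp
  then have D: "?D \<noteq> 0" by (metis fps_zero_nth)
  have "subdegree ?D \<le> 1" by (rule subdegree_leI) (use D1 in simp)
  moreover have "1 \<le> subdegree ?N" by (rule subdegree_geI) auto
  ultimately have "?D dvd ?N"
    using D by (subst fps_dvd_iff) auto
  moreover have "Abs_fps (\<lambda>l. bernoulli_poly l x / fact l) = ?N / ?D"
    by (simp add: fps_eq_iff bernoulli_poly_def)
  ultimately show ?thesis by simp
qed

text \<open>The \<open>p\<close>-adic order on the rationals, with values in the integers extended by infinity.\<close>

definition padic_ord :: "nat \<Rightarrow> rat \<Rightarrow> int extended" where
  "padic_ord p x =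
     (if x = 0 then \<infinity>
      else Fin (int (multiplicity (int p) (fst (quotient_of x)))
              - int (multiplicity (int p) (snd (quotient_of x)))))"

end

theory Submission
  imports Defs "HOL-Computational_Algebra.Polynomial"
begin

text \<open>
  Since \<open>B\<^sub>l(x / m) = (\<Sum>j\<le>l. (l choose j) B\<^sub>j x ^ (l - j) / m ^ (l - j))\<close> and \<open>p B\<^sub>j\<close> is
  \<open>p\<close>-integral, it suffices to bound the order of the moments
  \<open>\<Sum>k. (n choose k) (-1) ^ k (k - r) ^ i\<close> over a residue class modulo \<open>q = p ^ \<alpha>\<close>.

  For \<open>i = 0\<close> this is Weisman's congruence, read off from the powers of \<open>1 - x\<close> in
  \<open>\<int>[x] / (x ^ q - 1)\<close>: with \<open>y = x ^ (q / p)\<close> one has, modulo \<open>p\<close>,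
  \<open>(1 - x) ^ (q / p) = 1 - y\<close> and \<open>(1 - x) ^ \<phi>(q) = 1 + y + \<dots> + y ^ (p - 1) = F\<close>, where
  \<open>(1 - y) F = 0\<close> and \<open>F\<^sup>2 = p F\<close>.

  Higher moments reduce to lower ones through \<open>k (n choose k) = n ((n - 1) choose (k - 1))\<close>.
  For \<open>\<alpha> \<ge> 2\<close> the passage from \<open>n\<close> to \<open>n - 1\<close> costs nothing, because Weisman's exponent
  drops only when \<open>p\<close> divides the factor \<open>n\<close>.
\<close>

section \<open>Binomial congruences modulo \<open>p\<close> in an arbitrary commutative ring\<close>

lemma dvd_power_diff:
  fixes a b c :: "'a::comm_ring_1"
  assumes "c dvd a - b"
  shows "c dvd a ^ k - b ^ k"
proof (induction k)
  case (Suc k)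
  have "a ^ Suc k - b ^ Suc k = a * (a ^ k - b ^ k) + b ^ k * (a - b)"
    by (simp add: algebra_simps)
  then show ?case using Suc assms by simp
qed simp

lemma of_nat_dvd_of_nat: "a dvd b \<Longrightarrow> (of_nat a :: 'a::comm_semiring_1) dvd of_nat b"
  by (auto simp: dvd_def)

text \<open>Modulo \<open>p\<close> only the two extreme terms of the binomial expansion
  survive.\<close>

lemma prime_dvd_diff_power:
  fixes a b :: "'a::comm_ring_1"
  assumes p: "prime p"
  shows "of_nat p dvd (a - b) ^ p - (a ^ p - b ^ p)"
proof -
  have p0: "p > 0" using p by (simp add: prime_gt_0_nat)
  have "(a + (- b)) ^ p = (\<Sum>k\<le>p. of_nat (p choose k) * a ^ k * (- b) ^ (p - k))"
    by (rule binomial_ring)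
  also have "{..p} = insert 0 (insert p {1..<p})" using p0 by auto
  also have "(\<Sum>k\<in>\<dots>. of_nat (p choose k) * a ^ k * (- b) ^ (p - k)) =
      (- b) ^ p + a ^ p + (\<Sum>k\<in>{1..<p}. of_nat (p choose k) * a ^ k * (- b) ^ (p - k))"
    using p0 by (simp add: add.assoc)
  finally have expand: "(a - b) ^ p - (a ^ p + (- b) ^ p) =
      (\<Sum>k\<in>{1..<p}. of_nat (p choose k) * a ^ k * (- b) ^ (p - k))"
    by simp
  have "(of_nat p :: 'a) dvd (\<Sum>k\<in>{1..<p}. of_nat (p choose k) * a ^ k * (- b) ^ (p - k))"
    using p by (intro dvd_sum) (auto simp: mult.assoc intro!: dvd_mult2 of_nat_dvd_of_nat dvd_choose_prime)
  then have main: "of_nat p dvd (a - b) ^ p - (a ^ p + (- b) ^ p)" by (simp only: expand)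
  \<comment> \<open>For \<open>p = 2\<close> the sign in front of \<open>b ^ p\<close> comes out
    wrong, but the error \<open>2 * b ^ 2\<close> is itself a multiple of \<open>p\<close>.\<close>
  have "of_nat p dvd (- b) ^ p + b ^ p"
  proof (cases "p = 2")
    case True
    then show ?thesis by (simp add: dvd_def) (metis mult_2)
  next
    case False
    then have "odd p" using p by (metis prime_odd_nat prime_ge_2_nat le_neq_implies_less)
    then show ?thesis by simp
  qed
  from dvd_add[OF main this] show ?thesis by (simp add: algebra_simps)
qed

lemma prime_dvd_diff_power_prime_power:
  fixes x :: "'a::comm_ring_1"
  assumes p: "prime p"
  shows "of_nat p dvd (1 - x) ^ (p ^ N) - (1 - x ^ (p ^ N))"
proof (induction N)
  case (Suc N)
  have 1: "of_nat p dvd ((1 - x) ^ (p ^ N)) ^ p - (1 - x ^ (p ^ N)) ^ p"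
    using Suc by (rule dvd_power_diff)
  have 2: "of_nat p dvd (1 - x ^ (p ^ N)) ^ p - (1 ^ p - (x ^ (p ^ N)) ^ p)"
    by (rule prime_dvd_diff_power[OF p])
  from dvd_add[OF 1 2]
  have "of_nat p dvd ((1 - x) ^ (p ^ N)) ^ p - (1 - (x ^ (p ^ N)) ^ p)"
    by (simp add: algebra_simps)
  then show ?case by (simp only: power_mult[symmetric] power_Suc2)
qed simp

text \<open>Neighbouring entries of row \<open>p - 1\<close> of Pascal's triangle add up to an inner
  entry of row \<open>p\<close>, which \<open>p\<close> divides; so modulo \<open>p\<close> they
  alternate, starting from 1.\<close>

lemma prime_dvd_choose_pred:
  assumes p: "prime p" and "i < p"
  shows "int p dvd int ((p - 1) choose i) * (-1) ^ i - 1"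
  using \<open>i < p\<close>
proof (induction i)
  case (Suc i)
  have "int (p choose Suc i) = int ((p - 1) choose i) + int ((p - 1) choose Suc i)"
    using Suc.prems by (cases p) auto
  then have "int ((p - 1) choose Suc i) * (-1) ^ Suc i - 1
      = (int ((p - 1) choose i) * (-1) ^ i - 1) + (-1) ^ Suc i * int (p choose Suc i)"
    by (simp add: algebra_simps)
  moreover have "int p dvd int (p choose Suc i)"
    using p Suc.prems dvd_choose_prime by (intro of_nat_dvd_of_nat) auto
  ultimately show ?case using Suc by (simp only:) (intro dvd_add dvd_mult, auto)
qed simp

text \<open>Formally this is \<open>(1 - y) ^ p = 1 - y ^ p\<close> divided by \<open>1 - y\<close>.
  Comparing coefficients avoids the division, since \<open>1 - y\<close> may be a zero
  divisor.\<close>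

lemma prime_dvd_power_pred_diff_geometric:
  fixes y :: "'a::comm_ring_1"
  assumes p: "prime p"
  shows "of_nat p dvd (1 - y) ^ (p - 1) - (\<Sum>i<p. y ^ i)"
proof -
  have "(- y + 1) ^ (p - 1) = (\<Sum>i\<le>p - 1. of_nat ((p - 1) choose i) * (- y) ^ i * 1 ^ (p - 1 - i))"
    by (rule binomial_ring)
  also have "{..p - 1} = {..<p}" using prime_gt_0_nat[OF p] by auto
  finally have "(1 - y) ^ (p - 1) - (\<Sum>i<p. y ^ i)
      = (\<Sum>i<p. of_nat ((p - 1) choose i) * (- y) ^ i - y ^ i)"
    by (simp add: sum_subtractf)
  also have "\<dots> = (\<Sum>i<p. of_int (int ((p - 1) choose i) * (-1) ^ i - 1) * y ^ i)"
    by (rule sum.cong) (auto simp: algebra_simps power_minus[of y])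
  also have "of_nat p dvd \<dots>"
  proof (intro dvd_sum dvd_mult2)
    fix i assume "i \<in> {..<p}"
    then obtain c where c: "int ((p - 1) choose i) * (-1) ^ i - 1 = int p * c"
      using prime_dvd_choose_pred[OF p] by (auto simp: dvd_def)
    show "(of_nat p :: 'a) dvd of_int (int ((p - 1) choose i) * (-1) ^ i - 1)"
      unfolding c by simp
  qed
  finally show ?thesis .
qed

text \<open>Modulo \<open>E\<close>, the element \<open>D\<close> annihilates \<open>F\<close> and hence \<open>F\<^sup>2 = c F\<close>; so every
  factor \<open>F + c h\<close> beyond the first one contributes a factor \<open>c\<close>.\<close>

lemma power_in_ideal:
  fixes c D F E W g h :: "'a::comm_ring_1"
  assumes E: "D * F = E" and F: "F = c + D * W"
  shows "\<exists>A B. (D + c * g) * (F + c * h) ^ t = c ^ t * A + E * B"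
proof -
  have D_part: "\<exists>A B. D * (F + c * h) ^ t = c ^ t * A + E * B" for t
  proof (induction t)
    case 0
    have "D * (F + c * h) ^ 0 = c ^ 0 * D + E * 0" by simp
    then show ?case by blast
  next
    case (Suc t)
    then obtain A B where AB: "D * (F + c * h) ^ t = c ^ t * A + E * B" by blast
    have "D * (F + c * h) ^ Suc t = (D * F) * (F + c * h) ^ t + c * h * (D * (F + c * h) ^ t)"
      by (simp add: algebra_simps)
    also have "\<dots> = E * (F + c * h) ^ t + c * h * (c ^ t * A + E * B)"
      by (simp only: E AB)
    also have "\<dots> = c ^ Suc t * (h * A) + E * ((F + c * h) ^ t + c * h * B)"
      by (simp add: algebra_simps)
    finally show ?case by blast
  qed
  have FF: "F * F = c * F + E * W"
  proof -
    have "F * F = (c + D * W) * F" using F by simp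
    also have "\<dots> = c * F + D * F * W" by (simp add: algebra_simps)
    finally show ?thesis by (simp only: E)
  qed
  have c_part: "\<exists>A B C. c * (F + c * h) ^ t = c ^ t * (c * A + F * B) + E * C" for t
  proof (induction t)
    case 0
    have "c * (F + c * h) ^ 0 = c ^ 0 * (c * 1 + F * 0) + E * 0" by simp
    then show ?case by blast
  next
    case (Suc t)
    then obtain A B C where AB: "c * (F + c * h) ^ t = c ^ t * (c * A + F * B) + E * C" by blast
    have "c * (F + c * h) ^ Suc t = (c * (F + c * h) ^ t) * (F + c * h)"
      by (simp add: algebra_simps)
    also have "\<dots> = c ^ t * (c * (A * F) + c * c * A * h + (F * F) * B + c * F * B * h)
        + E * (C * (F + c * h))"
      unfolding AB by (simp add: algebra_simps)
    also have "\<dots> = c ^ Suc t * (c * (A * h) + F * (A + B + B * h))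
        + E * (C * (F + c * h) + c ^ t * W * B)"
      unfolding FF by (simp add: algebra_simps)
    finally show ?case by blast
  qed
  obtain A B where AB: "D * (F + c * h) ^ t = c ^ t * A + E * B" using D_part by blast
  obtain A' B' C where AB': "c * (F + c * h) ^ t = c ^ t * (c * A' + F * B') + E * C"
    using c_part by blast
  have "(D + c * g) * (F + c * h) ^ t = D * (F + c * h) ^ t + g * (c * (F + c * h) ^ t)"
    by (simp add: algebra_simps)
  also have "\<dots> = c ^ t * (A + g * (c * A' + F * B')) + E * (B + g * C)"
    unfolding AB AB' by (simp add: algebra_simps)
  finally show ?thesis by blast
qed

text \<open>\<open>power_in_ideal\<close> with \<open>c = p\<close> and \<open>D = 1 - y\<close>:
  one factor \<open>(1 - x) ^ (p ^ N)\<close> supplies \<open>D + c * g\<close>, and each of the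
  \<open>t\<close> factors of exponent \<open>p ^ N * (p - 1)\<close> supplies an
  \<open>F + c * h\<close>. The remaining \<open>s\<close> factors go into the cofactors.\<close>

lemma one_minus_power_in_ideal:
  fixes x :: "'a::comm_ring_1"
  assumes p: "prime p" and n: "p ^ N + t * (p ^ N * (p - 1)) \<le> n"
  shows "\<exists>A B. (1 - x) ^ n = of_nat p ^ t * A + (x ^ (p ^ Suc N) - 1) * B"
proof -
  define y where "y = x ^ (p ^ N)"
  define F where "F = (\<Sum>i<p. y ^ i)"
  have E: "(1 - y) * F = 1 - y ^ p"
    unfolding F_def by (simp add: one_diff_power_eq)
  have "1 - y dvd (\<Sum>i<p. y ^ i - 1 ^ i)"
  proof (intro dvd_sum dvd_power_diff)
    have "y - 1 = (1 - y) * (- 1)" by simp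
    then show "1 - y dvd y - 1" by (rule dvdI)
  qed
  then obtain W where "F - of_nat p = (1 - y) * W"
    by (auto simp: F_def sum_subtractf dvd_def)
  then have F: "F = of_nat p + (1 - y) * W" by (simp add: algebra_simps)
  obtain g where g: "(1 - x) ^ (p ^ N) - (1 - y) = of_nat p * g"
    using prime_dvd_diff_power_prime_power[OF p, of x N] by (auto simp: y_def dvd_def)
  have "of_nat p dvd (((1 - x) ^ (p ^ N)) ^ (p - 1) - (1 - y) ^ (p - 1)) + ((1 - y) ^ (p - 1) - F)"
    unfolding F_def
    by (intro dvd_add dvd_power_diff prime_dvd_power_pred_diff_geometric p) (simp add: g)
  then obtain h where h: "((1 - x) ^ (p ^ N)) ^ (p - 1) - F = of_nat p * h"
    by (auto simp: dvd_def)
  obtain A B where AB: "((1 - y) + of_nat p * g) * (F + of_nat p * h) ^ t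
      = of_nat p ^ t * A + (1 - y ^ p) * B"
    using power_in_ideal[OF E F] by blast
  obtain s where s: "n = p ^ N + t * (p ^ N * (p - 1)) + s" using n le_Suc_ex by blast
  have u: "(1 - x) ^ (p ^ N) = (1 - y) + of_nat p * g" using g by (simp add: algebra_simps)
  have v: "((1 - x) ^ (p ^ N)) ^ (p - 1) = F + of_nat p * h" using h by (simp add: algebra_simps)
  have "(1 - x) ^ n = (1 - x) ^ (p ^ N) * (((1 - x) ^ (p ^ N)) ^ (p - 1)) ^ t * (1 - x) ^ s"
    by (simp add: s power_add power_mult[symmetric] mult_ac)
  also have "\<dots> = (((1 - y) + of_nat p * g) * (F + of_nat p * h) ^ t) * (1 - x) ^ s"
    by (simp only: v, simp only: u)
  also have "\<dots> = of_nat p ^ t * (A * (1 - x) ^ s) + (y ^ p - 1) * (- (B * (1 - x) ^ s))"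
    unfolding AB by (simp add: algebra_simps)
  also have "y ^ p = x ^ (p ^ Suc N)"
    by (simp add: y_def power_mult[symmetric] mult.commute)
  finally show ?thesis by blast
qed

section \<open>From ideal membership in Z[x] to Weisman's congruence\<close>

text \<open>Adding up the coefficients whose index lies in the residue class is a linear functional.
  The class is invariant under a shift by \<open>q\<close>, so the functional kills multiples of
  \<open>x ^ q - 1\<close> and only \<open>c * A\<close> contributes.\<close>

lemma dvd_residue_class_sum_of_ideal:
  fixes c :: int and A B :: "int poly"
  assumes eq: "[:1, -1:] ^ n = [:c:] * A + (monom 1 q - 1) * B"
  shows "c dvd (\<Sum>k | k \<le> n \<and> [int k = r] (mod int q). int (n choose k) * (-1) ^ k)"
proof -
  \<comment> \<open>With this bound, the range up to \<open>N + q\<close> contains all coefficients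
    of the left side, of \<open>A\<close>, of \<open>B\<close> and of
    \<open>x ^ q * B\<close>.\<close>
  define N where "N = n + degree A + degree B"
  define \<chi> :: "nat \<Rightarrow> int" where "\<chi> k = of_bool ([int k = r] (mod int q))" for k
  have shift: "\<chi> (k + q) = \<chi> k" for k
    by (simp add: \<chi>_def cong_def)
  have "(\<Sum>k | k \<le> n \<and> [int k = r] (mod int q). int (n choose k) * (-1) ^ k)
      = (\<Sum>k\<le>n. \<chi> k * coeff ([:1, -1:] ^ n) k)"
    by (rule sum.mono_neutral_cong_left) (auto simp: \<chi>_def coeff_linear_poly_power)
  also have "\<dots> = (\<Sum>k\<le>N + q. \<chi> k * coeff ([:1, -1:] ^ n) k)"
    by (rule sum.mono_neutral_left)
      (auto simp: N_def intro!: coeff_eq_0 simp: degree_linear_power)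
  also have "\<dots> = c * (\<Sum>k\<le>N + q. \<chi> k * coeff A k)
      + ((\<Sum>k\<le>N + q. \<chi> k * coeff (monom 1 q * B) k) - (\<Sum>k\<le>N + q. \<chi> k * coeff B k))"
    unfolding eq
    by (simp add: left_diff_distrib sum_distrib_left sum.distrib sum_subtractf algebra_simps)
  also have "(\<Sum>k\<le>N + q. \<chi> k * coeff (monom 1 q * B) k)
      = (\<Sum>k\<in>(\<lambda>k. k + q) ` {..N}. \<chi> k * coeff (monom 1 q * B) k)"
  proof (rule sum.mono_neutral_right)
    show "\<forall>k\<in>{..N + q} - (\<lambda>k. k + q) ` {..N}. \<chi> k * coeff (monom 1 q * B) k = 0"
    proof
      fix k assume k: "k \<in> {..N + q} - (\<lambda>k. k + q) ` {..N}"
      have "k < q"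
      proof (rule ccontr)
        assume "\<not> k < q"
        then have "k = (k - q) + q" "k - q \<in> {..N}" using k by auto
        then show False using k by blast
      qed
      then show "\<chi> k * coeff (monom 1 q * B) k = 0" by (simp add: coeff_monom_mult)
    qed
  qed auto
  also have "\<dots> = (\<Sum>k\<le>N. \<chi> k * coeff B k)"
    by (subst sum.reindex) (auto simp: coeff_monom_mult shift)
  also have "\<dots> = (\<Sum>k\<le>N + q. \<chi> k * coeff B k)"
    by (rule sum.mono_neutral_left) (auto simp: N_def intro!: coeff_eq_0)
  finally show ?thesis by simp
qed

lemma weisman_congruence:
  assumes p: "prime p" and n: "p ^ N + t * (p ^ N * (p - 1)) \<le> n"
  shows "int p ^ t dvd
    (\<Sum>k | k \<le> n \<and> [int k = r] (mod int (p ^ Suc N)). int (n choose k) * (-1) ^ k)"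
proof -
  obtain A B where "(1 - [:0, 1:]) ^ n
      = of_nat p ^ t * A + ([:0, 1:] ^ (p ^ Suc N) - 1) * (B :: int poly)"
    using one_minus_power_in_ideal[OF p n] by blast
  moreover have "1 - [:0, 1:] = [:1, -1 :: int:]" by (simp add: one_pCons)
  moreover have "of_nat p ^ t = [:int p ^ t:]" by (simp add: of_nat_poly poly_const_pow)
  moreover have "[:0, 1:] ^ (p ^ Suc N) = monom (1 :: int) (p ^ Suc N)"
    by (simp add: monom_altdef)
  ultimately show ?thesis by (intro dvd_residue_class_sum_of_ideal[of n _ A _ B]) metis
qed

section \<open>Divisibility of higher moments over residue classes\<close>

text \<open>The modulus \<open>M n d\<close> is left abstract so that one induction serves both
  \<open>\<alpha> = 0\<close> and \<open>\<alpha> > 0\<close>. The hypothesis \<open>step\<close> is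
  the price of absorbing one factor \<open>k\<close> into the binomial coefficient, which lowers
  \<open>n\<close> and \<open>d\<close> by 1 and brings out the factor \<open>n\<close>.\<close>

lemma residue_class_poly_sum_dvd:
  fixes M :: "nat \<Rightarrow> nat \<Rightarrow> int"
  assumes base: "\<And>n d r. M n d dvd
      (\<Sum>k | k \<le> n \<and> [int k = r] (mod q). int (n choose k) * (-1) ^ k)"
    and step: "\<And>n d. M (Suc n) (Suc d) dvd int (Suc n) * M n d"
    and f: "degree f \<le> d"
  shows "M n d dvd (\<Sum>k | k \<le> n \<and> [int k = r] (mod q). int (n choose k) * (-1) ^ k * poly f (int k))"
  using f
proof (induction d arbitrary: f n r)
  case 0
  then obtain a where "f = [:a:]" using degree_eq_zeroE by blast
  then show ?case using base[of n 0 r] by (simp flip: sum_distrib_right)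
next
  case (Suc d)
  obtain a g where f: "f = pCons a g" by (cases f)
  define K where "K = {k. k \<le> n \<and> [int k = r] (mod q)}"
  have g: "degree g \<le> d" using Suc.prems by (simp add: f split: if_splits)
  have split: "(\<Sum>k\<in>K. int (n choose k) * (-1) ^ k * poly f (int k))
      = a * (\<Sum>k\<in>K. int (n choose k) * (-1) ^ k)
        + (\<Sum>k\<in>K. int (n choose k) * (-1) ^ k * (int k * poly g (int k)))"
    by (simp add: f sum_distrib_left sum.distrib algebra_simps)
  have "M n (Suc d) dvd (\<Sum>k\<in>K. int (n choose k) * (-1) ^ k * (int k * poly g (int k)))"
  proof (cases n)
    case 0
    then show ?thesis by (intro dvd_sum) (auto simp: K_def)
  next
    case (Suc n')
    \<comment> \<open>The term \<open>k = 0\<close> vanishes through its factor \<open>k\<close>.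
      Substituting \<open>k = j + 1\<close> moves the class to \<open>r - 1\<close> and replaces
      \<open>g\<close> by its composite with \<open>x + 1\<close>, which has the same
      degree.\<close>
    define J where "J = {j. j \<le> n' \<and> [int j = r - 1] (mod q)}"
    have cong_shift: "[int (Suc j) = r] (mod q) \<longleftrightarrow> [int j = r - 1] (mod q)" for j
      by (simp add: cong_iff_dvd_diff algebra_simps)
    have J: "Suc ` J = K - {0}"
    proof
      show "Suc ` J \<subseteq> K - {0}" using cong_shift by (auto simp: J_def K_def Suc)
      show "K - {0} \<subseteq> Suc ` J"
      proof
        fix k assume k: "k \<in> K - {0}"
        then obtain j where "k = Suc j" by (cases k) auto
        with k show "k \<in> Suc ` J" using cong_shift by (auto simp: J_def K_def Suc)
      qed
    qed
    have "(\<Sum>k\<in>K. int (n choose k) * (-1) ^ k * (int k * poly g (int k)))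
        = (\<Sum>k\<in>Suc ` J. int (n choose k) * (-1) ^ k * (int k * poly g (int k)))"
      by (rule sum.mono_neutral_right) (auto simp: J, auto simp: K_def)
    also have "\<dots> = (\<Sum>j\<in>J. int (Suc n' choose Suc j) * (-1) ^ Suc j * (int (Suc j) * poly g (int (Suc j))))"
      by (simp add: sum.reindex Suc)
    also have "\<dots> = (\<Sum>j\<in>J. - int (Suc n') * (int (n' choose j) * (-1) ^ j * poly (g \<circ>\<^sub>p [:1, 1:]) (int j)))"
    proof (rule sum.cong[OF refl])
      fix j
      have "int (Suc n' choose Suc j) * (-1) ^ Suc j * (int (Suc j) * poly g (int (Suc j)))
          = int (Suc j * (Suc n' choose Suc j)) * (- ((-1) ^ j) * poly g (int (Suc j)))"
        unfolding of_nat_mult by (simp add: mult_ac)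
      also have "\<dots> = - int (Suc n') * (int (n' choose j) * (-1) ^ j * poly g (int (Suc j)))"
        unfolding Suc_times_binomial of_nat_mult by (simp only: mult_ac mult_minus_left mult_minus_right)
      finally show "int (Suc n' choose Suc j) * (-1) ^ Suc j * (int (Suc j) * poly g (int (Suc j)))
          = - int (Suc n') * (int (n' choose j) * (-1) ^ j * poly (g \<circ>\<^sub>p [:1, 1:]) (int j))"
        by (simp add: poly_pcompose add.commute)
    qed
    also have "\<dots> = - (int (Suc n') * (\<Sum>j\<in>J. int (n' choose j) * (-1) ^ j * poly (g \<circ>\<^sub>p [:1, 1:]) (int j)))"
      by (simp only: sum_distrib_left[symmetric] mult_minus_left sum_negf)
    finally have eq: "(\<Sum>k\<in>K. int (n choose k) * (-1) ^ k * (int k * poly g (int k)))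
      = - (int (Suc n') * (\<Sum>j\<in>J. int (n' choose j) * (-1) ^ j * poly (g \<circ>\<^sub>p [:1, 1:]) (int j)))" .
    have "M n' d dvd (\<Sum>j\<in>J. int (n' choose j) * (-1) ^ j * poly (g \<circ>\<^sub>p [:1, 1:]) (int j))"
      unfolding J_def by (rule Suc.IH) (use g in \<open>simp add: degree_pcompose\<close>)
    then have "int (Suc n') * M n' d dvd
        int (Suc n') * (\<Sum>j\<in>J. int (n' choose j) * (-1) ^ j * poly (g \<circ>\<^sub>p [:1, 1:]) (int j))"
      by (rule mult_dvd_mono[OF dvd_refl])
    then show ?thesis
      unfolding eq dvd_minus_iff using step[of n' d] Suc dvd_trans by blast
  qed
  moreover have "M n (Suc d) dvd (\<Sum>k\<in>K. int (n choose k) * (-1) ^ k)"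
    unfolding K_def by (rule base)
  ultimately show ?case unfolding split[unfolded K_def] by (simp add: K_def)
qed

definition residue_class_moment :: "nat \<Rightarrow> nat \<Rightarrow> int \<Rightarrow> nat \<Rightarrow> int" where
  "residue_class_moment q n r i =
     (\<Sum>k | k \<le> n \<and> [int k = r] (mod int q). int (n choose k) * (-1) ^ k * (int k - r) ^ i)"

lemma residue_class_moment_dvd:
  fixes M :: "nat \<Rightarrow> nat \<Rightarrow> int"
  assumes "\<And>n d r. M n d dvd
      (\<Sum>k | k \<le> n \<and> [int k = r] (mod int q). int (n choose k) * (-1) ^ k)"
    and "\<And>n d. M (Suc n) (Suc d) dvd int (Suc n) * M n d"
  shows "M n i dvd residue_class_moment q n r i"
proof -
  have "M n i dvd (\<Sum>k | k \<le> n \<and> [int k = r] (mod int q).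
      int (n choose k) * (-1) ^ k * poly ([:- r, 1:] ^ i) (int k))"
    by (rule residue_class_poly_sum_dvd) (use assms in \<open>simp_all add: degree_linear_power\<close>)
  then show ?thesis by (simp add: residue_class_moment_def)
qed

text \<open>An \<open>n\<close>-th finite difference kills polynomials of degree below
  \<open>n\<close>. Vanishing is encoded as divisibility by the modulus 0.\<close>

lemma residue_class_moment_1_eq_0:
  assumes "i < n"
  shows "residue_class_moment 1 n r i = 0"
proof -
  define M :: "nat \<Rightarrow> nat \<Rightarrow> int" where "M n d = (if d < n then 0 else 1)" for n d
  have "M n i dvd residue_class_moment 1 n r i"
  proof (rule residue_class_moment_dvd)
    fix n d :: nat and r :: int
    have "(\<Sum>k | k \<le> n \<and> [int k = r] (mod int 1). int (n choose k) * (-1) ^ k)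
        = (\<Sum>k\<le>n. (-1) ^ k * int (n choose k))"
      by (rule sum.cong) (auto simp: mult.commute)
    then show "M n d dvd (\<Sum>k | k \<le> n \<and> [int k = r] (mod int 1). int (n choose k) * (-1) ^ k)"
      by (simp add: M_def choose_alternating_sum)
  qed (simp add: M_def)
  then show ?thesis using assms by (simp add: M_def)
qed

text \<open>For \<open>N = 0\<close> the subtracted degree keeps the exponent fixed when
  \<open>n\<close> and \<open>d\<close> both grow by 1, which makes \<open>step\<close> immediate.
  For \<open>N > 0\<close> no such correction is made, and a jump of the exponent is paid for by the
  factor \<open>n + 1\<close>.\<close>

lemma residue_class_moment_prime_power_dvd:
  fixes N :: nat
  assumes p: "prime p"
  shows "int p ^ ((n - p ^ N - i * of_bool (N = 0)) div (p ^ N * (p - 1)))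
      dvd residue_class_moment (p ^ Suc N) n r i"
proof -
  define M where
    "M n d = int p ^ ((n - p ^ N - d * of_bool (N = 0)) div (p ^ N * (p - 1)))" for n d
  have "M n i dvd residue_class_moment (p ^ Suc N) n r i"
  proof (rule residue_class_moment_dvd)
    fix n d :: nat and r :: int
    define t where "t = (n - p ^ N) div (p ^ N * (p - 1))"
    have "M n d dvd int p ^ t"
      unfolding M_def t_def by (intro le_imp_power_dvd div_le_mono) simp
    also have "int p ^ t dvd
        (\<Sum>k | k \<le> n \<and> [int k = r] (mod int (p ^ Suc N)). int (n choose k) * (-1) ^ k)"
    proof (cases "p ^ N \<le> n")
      case True
      have "t * (p ^ N * (p - 1)) \<le> n - p ^ N" by (simp only: t_def div_times_less_eq_dividend)
      then show ?thesis using True by (intro weisman_congruence[OF p]) linarith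
    qed (simp add: t_def)
    finally show "M n d dvd
        (\<Sum>k | k \<le> n \<and> [int k = r] (mod int (p ^ Suc N)). int (n choose k) * (-1) ^ k)" .
  next
    fix n d :: nat
    show "M (Suc n) (Suc d) dvd int (Suc n) * M n d"
    proof (cases "N = 0")
      case True
      then show ?thesis by (simp add: M_def)
    next
      case N: False
      show ?thesis
      proof (cases "p ^ N \<le> n \<and> Suc (n - p ^ N) mod (p ^ N * (p - 1)) = 0")
        case True
        \<comment> \<open>The exponent jumps only when \<open>p\<close> divides \<open>n + 1\<close>; this needs \<open>p\<close> to divide both
          \<open>p ^ N\<close> and \<open>p ^ N * (p - 1)\<close>, that is, \<open>N > 0\<close>.\<close>
        have "p dvd p ^ N" using N by simp
        moreover have "p dvd Suc (n - p ^ N)"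
          using True \<open>p dvd p ^ N\<close> by (meson dvd_eq_mod_eq_0 dvd_mult2 dvd_trans)
        ultimately have "p dvd p ^ N + Suc (n - p ^ N)" by (rule dvd_add)
        then have "p dvd Suc n" using True by simp
        then have "int p dvd int (Suc n)" by (rule of_nat_dvd_of_nat)
        moreover have "M (Suc n) (Suc d) = int p * M n d"
          using True N by (simp add: M_def Suc_diff_le div_Suc)
        ultimately show ?thesis by (simp add: mult_dvd_mono)
      next
        case False
        then have "(Suc n - p ^ N) div (p ^ N * (p - 1)) = (n - p ^ N) div (p ^ N * (p - 1))"
          by (cases "p ^ N \<le> n") (auto simp: Suc_diff_le div_Suc)
        then have "M (Suc n) (Suc d) = M n d" using N by (simp add: M_def)
        then show ?thesis by simp
      qed
    qed
  qed
  then show ?thesis by (simp only: M_def)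
qed

section \<open>Lower bounds for the \<open>p\<close>-adic order\<close>

text \<open>Membership in the fractional ideal generated by \<open>p powi e\<close> in the
  localization of Z at \<open>p\<close>. Fractions need not be reduced and 0 is no special case, so
  sums and products are easy to handle.\<close>

definition padic_ge :: "nat \<Rightarrow> int \<Rightarrow> rat \<Rightarrow> bool" where
  "padic_ge p e x \<longleftrightarrow> (\<exists>a b. \<not> int p dvd b \<and> x * of_int b = of_nat p powi e * of_int a)"

lemma padic_ord_ge:
  assumes p: "prime p" and x: "padic_ge p e x"
  shows "padic_ord p x \<ge> Fin e"
proof (cases "x = 0")
  case False
  have pr: "prime (int p)" using p by simp
  have p0: "(of_nat p :: rat) \<noteq> 0" using p by (simp add: prime_gt_0_nat)
  obtain a b where ab: "\<not> int p dvd b" "x * of_int b = of_nat p powi e * of_int a"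
    using x by (auto simp: padic_ge_def)
  obtain u v where uv: "quotient_of x = (u, v)" by (cases "quotient_of x")
  have v: "v > 0" and xuv: "x = of_int u / of_int v"
    using uv quotient_of_denom_pos quotient_of_div by blast+
  have u0: "u \<noteq> 0" using False xuv by auto
  have b0: "b \<noteq> 0" using ab by auto
  have a0: "a \<noteq> 0" using ab False b0 by auto
  \<comment> \<open>Splitting \<open>e\<close> into positive and negative part clears all
    denominators; multiplicities are then compared in an equation between integers.\<close>
  define s t where "s = nat e" and "t = nat (- e)"
  have e: "e = int s - int t" by (auto simp: s_def t_def)
  have "of_nat p powi e * of_nat p ^ t = (of_nat p :: rat) ^ s"
    using p0 by (simp add: e power_int_diff)
  then have "of_int (u * b * int p ^ t) = (of_int (int p ^ s * a * v) :: rat)"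
    using ab(2) v unfolding xuv
    by (simp add: field_simps) (metis mult.assoc mult.commute)
  then have eq: "u * b * int p ^ t = int p ^ s * a * v" by (simp only: of_int_eq_iff)
  have "multiplicity (int p) (u * b * int p ^ t) = multiplicity (int p) u + t"
    using pr u0 b0 ab(1)
    by (simp add: prime_elem_multiplicity_mult_distrib not_dvd_imp_multiplicity_0)
  moreover have "multiplicity (int p) (int p ^ s * a * v)
      = s + multiplicity (int p) a + multiplicity (int p) v"
    using pr a0 v by (simp add: prime_elem_multiplicity_mult_distrib)
  ultimately show ?thesis using False eq by (simp add: padic_ord_def uv e)
qed (simp add: padic_ord_def)

lemma padic_ge_0: "prime p \<Longrightarrow> padic_ge p e 0"
  unfolding padic_ge_def by (rule exI[of _ 0], rule exI[of _ 1]) (auto dest: not_prime_unit)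

lemma padic_ge_add:
  assumes p: "prime p" and "padic_ge p e x" "padic_ge p e y"
  shows "padic_ge p e (x + y)"
proof -
  obtain a b where ab: "\<not> int p dvd b" "x * of_int b = of_nat p powi e * of_int a"
    using assms by (auto simp: padic_ge_def)
  obtain c d where cd: "\<not> int p dvd d" "y * of_int d = of_nat p powi e * of_int c"
    using assms by (auto simp: padic_ge_def)
  have "\<not> int p dvd b * d" using ab(1) cd(1) p by (simp add: prime_dvd_mult_iff)
  moreover have "(x + y) * of_int (b * d)
      = (x * of_int b) * of_int d + (y * of_int d) * of_int b"
    by (simp add: algebra_simps)
  then have "(x + y) * of_int (b * d) = of_nat p powi e * of_int (a * d + c * b)"
    unfolding ab cd by (simp add: algebra_simps)
  ultimately show ?thesis unfolding padic_ge_def by blast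
qed

lemma padic_ge_sum:
  assumes "prime p" and "\<And>i. i \<in> I \<Longrightarrow> padic_ge p e (f i)"
  shows "padic_ge p e (\<Sum>i\<in>I. f i)"
  using assms(2)
  by (induction I rule: infinite_finite_induct) (auto intro: padic_ge_0 padic_ge_add assms(1))

lemma padic_ge_mult:
  assumes p: "prime p" and "padic_ge p e x" "padic_ge p f y"
  shows "padic_ge p (e + f) (x * y)"
proof -
  obtain a b where ab: "\<not> int p dvd b" "x * of_int b = of_nat p powi e * of_int a"
    using assms by (auto simp: padic_ge_def)
  obtain c d where cd: "\<not> int p dvd d" "y * of_int d = of_nat p powi f * of_int c"
    using assms by (auto simp: padic_ge_def)
  have "\<not> int p dvd b * d" using ab(1) cd(1) p by (simp add: prime_dvd_mult_iff)
  moreover have "(x * y) * of_int (b * d) = (x * of_int b) * (y * of_int d)"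
    by (simp add: algebra_simps)
  then have "(x * y) * of_int (b * d) = of_nat p powi (e + f) * of_int (a * c)"
    unfolding ab cd using prime_gt_0_nat[OF p] by (simp add: power_int_add algebra_simps)
  ultimately show ?thesis unfolding padic_ge_def by blast
qed

lemma padic_ge_of_int:
  assumes p: "prime p" and "int p ^ k dvd z"
  shows "padic_ge p (int k) (of_int z)"
proof -
  from assms obtain a where "z = int p ^ k * a" by (auto simp: dvd_def)
  moreover have "\<not> int p dvd 1" using p not_prime_unit by auto
  ultimately show ?thesis
    unfolding padic_ge_def by (intro exI[of _ a] exI[of _ 1]) simp
qed

lemma padic_ge_of_int_0: "prime p \<Longrightarrow> padic_ge p 0 (of_int z)"
  using padic_ge_of_int[of p 0 z] by simp

lemma padic_ge_of_nat_0: "prime p \<Longrightarrow> padic_ge p 0 (of_nat z)"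
  using padic_ge_of_int_0[of p "int z"] by simp

lemma padic_ge_mono:
  assumes p: "prime p" and x: "padic_ge p e x" and "f \<le> e"
  shows "padic_ge p f x"
proof -
  obtain a b where ab: "\<not> int p dvd b" "x * of_int b = of_nat p powi e * of_int a"
    using x by (auto simp: padic_ge_def)
  have "of_nat p powi e = (of_nat p powi f * of_nat p powi (e - f) :: rat)"
    using prime_gt_0_nat[OF p] by (simp flip: power_int_add)
  also have "of_nat p powi (e - f) = (of_int (int p ^ nat (e - f)) :: rat)"
    using \<open>f \<le> e\<close> by (simp add: power_int_def)
  finally have "x * of_int b = of_nat p powi f * of_int (int p ^ nat (e - f) * a)"
    by (simp add: ab(2) mult.assoc)
  then show ?thesis unfolding padic_ge_def using ab(1) by blast
qed

lemma padic_ge_inverse: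
  assumes p: "prime p" and "m > 0"
  shows "padic_ge p (- int (multiplicity p m)) (1 / of_nat m)"
proof -
  obtain u where u: "m = p ^ multiplicity p m * u" "\<not> p dvd u"
    using multiplicity_decompose'[of m p] assms not_prime_unit by blast
  have "(of_nat m :: rat) = of_nat p ^ multiplicity p m * of_nat u"
    by (subst u(1)) simp
  moreover have "(of_nat p :: rat) \<noteq> 0" using prime_gt_0_nat[OF p] by simp
  moreover have "(of_nat u :: rat) \<noteq> 0" using u(2) by (cases "u = 0") auto
  ultimately have "1 / of_nat m * of_int (int u)
      = of_nat p powi (- int (multiplicity p m)) * (of_int 1 :: rat)"
    by (simp add: power_int_minus field_simps)
  moreover have "\<not> int p dvd int u" using u by simp
  ultimately show ?thesis unfolding padic_ge_def by blast
qed

lemma padic_ge_power: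
  assumes p: "prime p" and "padic_ge p e x"
  shows "padic_ge p (int i * e) (x ^ i)"
proof (induction i)
  case 0
  show ?case using padic_ge_of_int_0[OF p, of 1] by simp
next
  case (Suc i)
  from padic_ge_mult[OF p assms(2) this] show ?case by (simp add: algebra_simps)
qed

section \<open>Bernoulli numbers and their denominators at \<open>p\<close>\<close>

text \<open>The generating function at \<open>x\<close> is the one at 0 times
  \<open>fps_exp x\<close>, after cancelling the nonzero series \<open>fps_exp 1 - 1\<close>;
  coefficients are then compared.\<close>

lemma bernoulli_poly_eq_sum:
  "bernoulli_poly l x = (\<Sum>j\<le>l. of_nat (l choose j) * bernoulli_poly j 0 * x ^ (l - j))"
proof -
  define G where "G x = Abs_fps (\<lambda>l. bernoulli_poly l x / fact l)" for x
  have G: "G x * (fps_exp 1 - 1) = fps_X * fps_exp x" for x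
    unfolding G_def by (rule bernoulli_poly_generating_function)
  have "fps_nth (fps_exp 1 - 1 :: rat fps) 1 \<noteq> 0" by simp
  then have nz: "fps_exp 1 - 1 \<noteq> (0 :: rat fps)" by (metis fps_zero_nth)
  have "(G 0 * fps_exp x) * (fps_exp 1 - 1) = (G 0 * (fps_exp 1 - 1)) * fps_exp x"
    by (simp only: mult_ac)
  also have "\<dots> = G x * (fps_exp 1 - 1)" by (simp add: G)
  finally have "G x = G 0 * fps_exp x" using nz by simp
  then have "fps_nth (G x) l = fps_nth (G 0 * fps_exp x) l" by simp
  then have "bernoulli_poly l x / fact l
      = (\<Sum>j=0..l. bernoulli_poly j 0 / fact j * (x ^ (l - j) / fact (l - j)))"
    by (simp add: G_def fps_mult_nth)
  then have "bernoulli_poly l x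
      = fact l * (\<Sum>j=0..l. bernoulli_poly j 0 / fact j * (x ^ (l - j) / fact (l - j)))"
    by (subst (asm) divide_eq_eq) (simp add: mult.commute)
  also have "\<dots> = (\<Sum>j\<le>l. of_nat (l choose j) * bernoulli_poly j 0 * x ^ (l - j))"
    unfolding sum_distrib_left atLeast0AtMost
    by (rule sum.cong) (auto simp: binomial_fact field_simps)
  finally show ?thesis .
qed

text \<open>Faulhaber's formula: multiplying the generating function at 0 by
  \<open>fps_exp N - 1\<close> leaves \<open>fps_X\<close> times a geometric sum.\<close>

lemma bernoulli_poly_power_sum:
  "(\<Sum>i\<le>j. of_nat (j choose i) * bernoulli_poly i 0 * of_nat N ^ (Suc j - i) / of_nat (Suc j - i))
    = (\<Sum>k<N. of_nat k ^ j)"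
proof -
  define G where "G = Abs_fps (\<lambda>l. bernoulli_poly l 0 / fact l)"
  have G: "G * (fps_exp 1 - 1) = fps_X"
    using bernoulli_poly_generating_function[of 0] by (simp add: G_def)
  have "fps_exp (of_nat N) - 1 = (fps_exp 1 - 1) * (\<Sum>k<N. fps_exp 1 ^ k :: rat fps)"
    using power_diff_1_eq[of "fps_exp 1 :: rat fps" N] by (simp add: fps_exp_power_mult)
  then have "G * (fps_exp (of_nat N) - 1) = fps_X * (\<Sum>k<N. fps_exp (of_nat k))"
    by (simp add: G mult.assoc[symmetric] fps_exp_power_mult)
  then have "fps_nth (G * (fps_exp (of_nat N) - 1)) (Suc j)
      = fps_nth (fps_X * (\<Sum>k<N. fps_exp (of_nat k))) (Suc j)" by simp
  moreover have "fps_nth (fps_X * (\<Sum>k<N. fps_exp (of_nat k :: rat))) (Suc j)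
      = (\<Sum>k<N. of_nat k ^ j / fact j)"
    by (simp add: fps_sum_nth)
  \<comment> \<open>The term \<open>i = Suc j\<close> of the Cauchy product drops out because
    \<open>fps_exp N - 1\<close> has constant term 0.\<close>
  moreover have "fps_nth (G * (fps_exp (of_nat N) - 1)) (Suc j)
      = (\<Sum>i\<le>j. bernoulli_poly i 0 / fact i * (of_nat N ^ (Suc j - i) / fact (Suc j - i)))"
    unfolding fps_mult_nth atLeast0AtMost sum.atMost_Suc
    by (auto simp: G_def intro!: sum.cong)
  ultimately have "(\<Sum>i\<le>j. bernoulli_poly i 0 / fact i * (of_nat N ^ (Suc j - i) / fact (Suc j - i)))
      = (\<Sum>k<N. of_nat k ^ j / fact j)"
    by (simp only:)
  then have "fact j * (\<Sum>i\<le>j. bernoulli_poly i 0 / fact i * (of_nat N ^ (Suc j - i) / fact (Suc j - i)))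
      = fact j * (\<Sum>k<N. of_nat k ^ j / fact j)" by simp
  moreover have "fact j * (bernoulli_poly i 0 / fact i * (of_nat N ^ (Suc j - i) / fact (Suc j - i)))
      = of_nat (j choose i) * bernoulli_poly i 0 * of_nat N ^ (Suc j - i) / of_nat (Suc j - i)"
    if "i \<le> j" for i
    using that by (simp add: binomial_fact Suc_diff_le field_simps del: of_nat_Suc)
  ultimately show ?thesis by (simp add: sum_distrib_left)
qed

text \<open>If \<open>p ^ v\<close> divides \<open>s + 1\<close>, then
  \<open>p ^ v \<le> s + 1 \<le> 2 ^ s \<le> p ^ s\<close>, hence \<open>v \<le> s\<close>.\<close>

lemma padic_ge_power_div_Suc:
  assumes p: "prime p"
  shows "padic_ge p 0 (of_nat p ^ s / of_nat (Suc s))"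
proof -
  define v where "v = multiplicity p (Suc s)"
  have "p ^ v \<le> Suc s" unfolding v_def by (intro dvd_imp_le multiplicity_dvd) simp
  also have "Suc s \<le> 2 ^ s" by (induction s) auto
  also have "\<dots> \<le> p ^ s" using prime_ge_2_nat[OF p] by (intro power_mono) auto
  finally have "v \<le> s" using prime_gt_1_nat[OF p] by (simp only: power_increasing_iff)
  have "padic_ge p (int s) (of_int (int p ^ s))" by (rule padic_ge_of_int[OF p]) simp
  from padic_ge_mult[OF p this padic_ge_inverse[OF p zero_less_Suc[of s]]]
  have "padic_ge p (int s - int v) (of_nat p ^ s / of_nat (Suc s))" by (simp add: v_def)
  then show ?thesis by (rule padic_ge_mono[OF p]) (use \<open>v \<le> s\<close> in simp)
qed

text \<open>The weak half of the von Staudt--Clausen theorem: the power sum over \<open>k < p\<close> expresses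
  \<open>p B\<^sub>j\<close> through the \<open>p B\<^sub>i\<close> with \<open>i < j\<close>, with \<open>p\<close>-integral coefficients
  \<open>p ^ (j - i) / (j - i + 1)\<close>.\<close>

lemma padic_ge_p_bernoulli:
  assumes p: "prime p"
  shows "padic_ge p 0 (of_nat p * bernoulli_poly j 0)"
proof (induction j rule: less_induct)
  case (less j)
  define T where "T i = of_nat (j choose i) * (of_nat p * bernoulli_poly i 0)
      * (of_nat p ^ (j - i) / of_nat (Suc (j - i)))" for i
  have "(\<Sum>i\<le>j. T i) = (\<Sum>i\<le>j. of_nat (j choose i) * bernoulli_poly i 0
      * of_nat p ^ (Suc j - i) / of_nat (Suc j - i))"
    by (rule sum.cong) (simp_all add: T_def Suc_diff_le)
  also have "\<dots> = of_int (\<Sum>k<p. int k ^ j)" by (simp only: bernoulli_poly_power_sum of_int_sum of_int_power of_int_of_nat_eq)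
  finally have "of_nat p * bernoulli_poly j 0
      = of_int (\<Sum>k<p. int k ^ j) + of_int (- 1) * (\<Sum>i<j. T i)"
    by (simp add: T_def flip: lessThan_Suc_atMost)
  moreover have "padic_ge p (0 + 0) (of_int (- 1) * (\<Sum>i<j. T i))"
  proof (intro padic_ge_mult[OF p] padic_ge_of_int_0[OF p] padic_ge_sum[OF p])
    fix i assume "i \<in> {..<j}"
    then have "padic_ge p (0 + 0 + 0) (T i)"
      unfolding T_def using less
      by (intro padic_ge_mult[OF p] padic_ge_of_nat_0[OF p] padic_ge_power_div_Suc[OF p]) auto
    then show "padic_ge p 0 (T i)" by simp
  qed
  ultimately show ?case
    using padic_ge_add[OF p padic_ge_of_int_0[OF p, of "\<Sum>k<p. int k ^ j"]]
    by (simp only: add_0_left)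
qed

lemma bernoulli_poly_0: "bernoulli_poly 0 x = 1"
proof -
  have "fps_nth (Abs_fps (\<lambda>l. bernoulli_poly l x / fact l) * (fps_exp 1 - 1)) 1
      = fps_nth (fps_X * fps_exp x) 1"
    by (simp only: bernoulli_poly_generating_function)
  then show ?thesis by (simp add: fps_mult_nth)
qed

text \<open>The lossless case \<open>j = 0\<close> is kept apart because in the theorem, for
  \<open>\<alpha> > 0\<close>, a loss of 1 is absorbed by \<open>j * \<alpha>\<close>.\<close>

lemma padic_ge_bernoulli:
  assumes p: "prime p"
  shows "padic_ge p (- of_bool (j > 0)) (bernoulli_poly j 0)"
proof (cases "j = 0")
  case True
  then show ?thesis using padic_ge_of_int_0[OF p, of 1] by (simp add: bernoulli_poly_0)
next
  case False
  have "multiplicity p p = 1" using p by (simp add: multiplicity_self not_prime_unit prime_gt_0_nat)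
  then have "padic_ge p (- 1) (1 / of_nat p)"
    using padic_ge_inverse[OF p prime_gt_0_nat[OF p]] by simp
  from padic_ge_mult[OF p this padic_ge_p_bernoulli[OF p, of j]]
  show ?thesis using False prime_gt_0_nat[OF p] by simp
qed

section \<open>Combining moments and Bernoulli numbers\<close>

lemma sum_bernoulli_poly_eq_moments:
  "(\<Sum>k | k \<le> n \<and> [int k = r] (mod int q).
      of_nat (n choose k) * (-1) ^ k * bernoulli_poly l (of_int (int k - r) / of_nat m))
    = (\<Sum>j\<le>l. of_nat (l choose j) * bernoulli_poly j 0 * (1 / of_nat m) ^ (l - j)
        * of_int (residue_class_moment q n r (l - j)))"
proof -
  define K where "K = {k. k \<le> n \<and> [int k = r] (mod int q)}"
  have "(\<Sum>k\<in>K. of_nat (n choose k) * (-1) ^ k * bernoulli_poly l (of_int (int k - r) / of_nat m))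
      = (\<Sum>k\<in>K. \<Sum>j\<le>l. of_nat (l choose j) * bernoulli_poly j 0 * (1 / of_nat m) ^ (l - j)
          * of_int (int (n choose k) * (-1) ^ k * (int k - r) ^ (l - j)))"
    unfolding bernoulli_poly_eq_sum[of l] sum_distrib_left
    by (intro sum.cong refl) (simp add: power_divide mult_ac)
  also have "\<dots> = (\<Sum>j\<le>l. \<Sum>k\<in>K. of_nat (l choose j) * bernoulli_poly j 0 * (1 / of_nat m) ^ (l - j)
          * of_int (int (n choose k) * (-1) ^ k * (int k - r) ^ (l - j)))"
    by (rule sum.swap)
  finally show ?thesis
    by (simp only: residue_class_moment_def K_def of_int_sum sum_distrib_left)
qed

text \<open>Truncated subtraction can only enlarge the numerator.\<close>

lemma floor_diff_divide_le:
  "\<lfloor>(of_nat n - of_nat a) / (of_nat d :: rat)\<rfloor> \<le> int ((n - a) div d)"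
proof -
  have "(of_nat n - of_nat a) / (of_nat d :: rat) \<le> of_nat (n - a) / of_nat d"
    by (intro divide_right_mono) (cases "a \<le> n"; simp add: of_nat_diff)+
  then have "\<lfloor>(of_nat n - of_nat a) / (of_nat d :: rat)\<rfloor> \<le> \<lfloor>of_nat (n - a) / (of_nat d :: rat)\<rfloor>"
    by (rule floor_mono)
  then show ?thesis by (simp only: floor_divide_of_nat_eq)
qed

theorem corollary1p1:
  fixes p m \<alpha> l n :: nat and r :: int
  assumes "prime p" and "m > 0" and "\<alpha> = multiplicity p m"
  shows "padic_ord p
           (\<Sum>k | k \<le> n \<and> [int k = r] (mod int (p ^ \<alpha>)).
              of_nat (n choose k) * (-1) ^ k * bernoulli_poly l (of_int (int k - r) / of_nat m))
         \<ge> Fin (\<lfloor>(of_nat n - of_nat p powi (int \<alpha> - 1)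
                    - of_nat l * (of_bool (\<alpha> = 0) + of_bool (\<alpha> = 1)))
                  / (of_nat (totient (p ^ \<alpha>)) :: rat)\<rfloor> - int l * int \<alpha>)"
    (is "padic_ord p ?S \<ge> Fin (\<lfloor>?x\<rfloor> - _)")
proof -
  note p = assms(1)
  define T where "T j = of_nat (l choose j) * bernoulli_poly j 0 * (1 / of_nat m) ^ (l - j)
      * of_int (residue_class_moment (p ^ \<alpha>) n r (l - j))" for j
  have S: "?S = (\<Sum>j\<le>l. T j)"
    unfolding T_def by (rule sum_bernoulli_poly_eq_moments)
  \<comment> \<open>The orders of the four factors of \<open>T j\<close> add up: 0 for the binomial
    coefficient, \<open>- of_bool (j > 0)\<close> for the Bernoulli number,
    \<open>- (l - j) * \<alpha>\<close> for the power of \<open>1 / m\<close>, and \<open>w\<close>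
    for the moment.\<close>
  have T_ge: "padic_ge p (\<lfloor>?x\<rfloor> - int l * int \<alpha>) (T j)"
    if "j \<le> l" and "int p ^ w dvd residue_class_moment (p ^ \<alpha>) n r (l - j)"
      and "\<lfloor>?x\<rfloor> - int l * int \<alpha> \<le> int w - of_bool (j > 0) - int (l - j) * int \<alpha>" for j w
  proof -
    have "padic_ge p (0 + - of_bool (j > 0) + int (l - j) * - int \<alpha> + int w) (T j)"
      unfolding T_def assms(3) using assms(2) that(2)
      by (intro padic_ge_mult[OF p] padic_ge_of_nat_0[OF p] padic_ge_bernoulli[OF p]
          padic_ge_power[OF p] padic_ge_inverse[OF p] padic_ge_of_int[OF p]) (simp_all add: assms(3))
    then show ?thesis by (rule padic_ge_mono[OF p]) (use that(3) in simp)
  qed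
  have "padic_ge p (\<lfloor>?x\<rfloor> - int l * int \<alpha>) (\<Sum>j\<le>l. T j)"
  proof (cases \<alpha>)
    case 0
    \<comment> \<open>The residue class is all of Z. If \<open>l < n\<close>, all moments vanish.
      Otherwise the term \<open>1 / p\<close> makes the floor negative, which covers the single
      \<open>p\<close> in the denominator of a Bernoulli number.\<close>
    show ?thesis
    proof (cases "l < n")
      case True
      then have "T j = 0" for j
        using residue_class_moment_1_eq_0[of "l - j" n r] by (simp add: T_def 0)
      then show ?thesis by (simp add: padic_ge_0[OF p])
    next
      case False
      have "inverse (of_nat p) > (0 :: rat)" using prime_gt_0_nat[OF p] by simp
      moreover have "of_nat n \<le> (of_nat l :: rat)" using False by simp
      ultimately have "of_nat n - inverse (of_nat p) - of_nat l < (0 :: rat)" by linarith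
      then have "?x < of_int 0" by (simp add: 0 power_int_minus del: diff_less_0_iff_less)
      then have x: "\<lfloor>?x\<rfloor> < 0" by (simp only: floor_less_iff)
      show ?thesis
      proof (intro padic_ge_sum[OF p] T_ge[where w = 0])
        fix j :: nat
        have "of_bool (j > 0) \<le> (1 :: int)" by simp
        with x show "\<lfloor>?x\<rfloor> - int l * int \<alpha> \<le> int 0 - of_bool (j > 0) - int (l - j) * int \<alpha>"
          unfolding \<open>\<alpha> = 0\<close> of_nat_0 mult_zero_right by linarith
      qed simp_all
    qed
  next
    case (Suc N)
    define d where "d = p ^ N * (p - 1)"
    have totient: "totient (p ^ \<alpha>) = d" by (simp only: Suc totient_prime_power_Suc[OF p] d_def)
    have "?x = (of_nat n - of_nat (p ^ N + l * of_bool (N = 0))) / of_nat d"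
      unfolding totient by (simp add: Suc)
    then have x: "\<lfloor>?x\<rfloor> \<le> int ((n - (p ^ N + l * of_bool (N = 0))) div d)"
      by (simp only: floor_diff_divide_le)
    show ?thesis
    proof (intro padic_ge_sum[OF p])
      fix j assume "j \<in> {..l}"
      then have j: "j \<le> l" by simp
      define w where "w = (n - p ^ N - (l - j) * of_bool (N = 0)) div d"
      \<comment> \<open>The moment has degree \<open>l - j\<close> only, so subtracting all of
        \<open>l\<close> gives a bound that serves every \<open>j\<close>.\<close>
      have "(n - (p ^ N + l * of_bool (N = 0))) div d \<le> w"
        unfolding w_def by (intro div_le_mono) (auto split: if_splits)
      then have "\<lfloor>?x\<rfloor> \<le> int w" using x by linarith
      moreover have "of_bool (j > 0) \<le> int j * int \<alpha>"
        using mult_mono[of 1 "int j" 1 "int \<alpha>"] by (cases j) (simp_all add: Suc)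
      moreover have "int (l - j) * int \<alpha> = int l * int \<alpha> - int j * int \<alpha>"
        using j by (simp add: of_nat_diff left_diff_distrib)
      ultimately have "\<lfloor>?x\<rfloor> - int l * int \<alpha> \<le> int w - of_bool (j > 0) - int (l - j) * int \<alpha>"
        by linarith
      moreover have "int p ^ w dvd residue_class_moment (p ^ \<alpha>) n r (l - j)"
        unfolding w_def d_def Suc by (rule residue_class_moment_prime_power_dvd[OF p])
      ultimately show "padic_ge p (\<lfloor>?x\<rfloor> - int l * int \<alpha>) (T j)" using T_ge j by blast
    qed
  qed
  then show ?thesis unfolding S by (rule padic_ord_ge[OF p])
qed

end
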